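(* Let $\alpha=(a_1,\dots,a_n)$ be a minimal zero-sum sequence of elements of a finite abelian group. If $|\Sigma(\alpha)|<2(n-1)$, then there are a group element $a$ and positive integers $x_1,\dots,x_n$ such that $x_1+\dots+x_n=\operatorname{ord}(a)$ and $a_k=x_k a$ for all $k\in[1,n]$.
   Context: A finite sequence of elements of an abelian group (written additively, terms may repeat) is zero-sum if the sum of its terms is $0$; it is minimal zero-sum if, in addition, none of its nonempty proper subsequences is zero-sum. For $\alpha=(a_1,\dots,a_n)$, the set of all subsequence sums, including the empty subsequence with sum $0$, is $\Sigma(\alpha)=\{\sum_{i\in I}a_i : I\subseteq[1,n]\}$. Here $[1,n]=\{1,2,\dots,n\}$, and $\operatorname{ord}(a)$ is the order of the group element $a$. *)

theory Defs
  imports "HOL-Algebra.Multiplicative_Group"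
begin

(* Groups are HOL-Algebra structures, hence written multiplicatively: \<one>\<^bsub>G\<^esub> is the zero
   element, finprod the sum, and g [^]\<^bsub>G\<^esub> k the multiple k g.  A sequence (a 1, ..., a n) is
   a function on the index set {1..n}; a subsequence is given by its index set I, so that
   repeated terms are counted with multiplicity. *)

definition zero_sum :: "('g, 'r) monoid_scheme \<Rightarrow> nat set \<Rightarrow> (nat \<Rightarrow> 'g) \<Rightarrow> bool" where
  "zero_sum G I a \<longleftrightarrow> finprod G a I = \<one>\<^bsub>G\<^esub>"

definition minimal_zero_sum :: "('g, 'r) monoid_scheme \<Rightarrow> nat \<Rightarrow> (nat \<Rightarrow> 'g) \<Rightarrow> bool" where
  "minimal_zero_sum G n a \<longleftrightarrow>
     zero_sum G {1..n} a \<and> (\<forall>I. I \<subset> {1..n} \<and> I \<noteq> {} \<longrightarrow> \<not> zero_sum G I a)"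

definition subsequence_sums :: "('g, 'r) monoid_scheme \<Rightarrow> nat \<Rightarrow> (nat \<Rightarrow> 'g) \<Rightarrow> 'g set" where
  "subsequence_sums G n a = {finprod G a I | I. I \<subseteq> {1..n}}"

end

theory Submission
  imports Defs
begin

text \<open>
  Deleting one term from a minimal zero-sum sequence leaves a sequence without nonempty zero-sum
  subsequences, and the deleted term is the inverse of the product of the others (sums are written
  as products in \<open>G\<close>, but still called sums below).  So it suffices to describe a zero-sum free
  sequence of length \<open>l\<close> with fewer than \<open>2 l\<close> subsequence sums, counting the empty one:
  its terms are powers \<open>g [^] x k\<close> with positive exponents of total
  \<open>m < ord g\<close>, and its sums are exactly \<open>g [^] 0, \<dots>, g [^] m\<close> (\<open>zero_sum_free_few_sums\<close>).
  The exponent of the deleted term is then \<open>ord g - m\<close>.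

  This description is proved by induction on \<open>l\<close>.  Let \<open>Y\<close> be the set of sums, \<open>s\<close> the sum of
  all terms, and \<open>X\<close> the set of sums that avoid a given term \<open>b\<close>.  Zero-sum freeness gives
  \<open>s \<in> Y - X\<close>, so every term contributes at least one new sum.

  If some term \<open>b\<close> contributes at least two, deleting it lowers both sides of
  \<open>card Y < 2 l\<close> enough for the induction hypothesis, so \<open>X\<close> is a progression \<open>g [^] 0, \<dots>, g [^] m\<close> with \<open>m \<ge> l - 1\<close>.
  Were \<open>X\<close> and its translate by \<open>b\<close> disjoint, \<open>Y\<close> would have \<open>2 (m + 1) \<ge> 2 l\<close> elements; hence they
  overlap, which forces \<open>b\<close> to be a power of \<open>g\<close> that prolongs the progression
  (\<open>progression_overlapping_translate\<close>).

  If every term contributes exactly one new sum, then \<open>Y = X \<union> {s}\<close> for every choice of \<open>b\<close>,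
  so \<open>Y - {s}\<close> is mapped into \<open>Y\<close> by every term.  Two distinct terms cannot coexist under this
  strong closure property (\<open>one_new_sum_imp_all_equal\<close>), and a constant zero-sum free sequence has the
  required form with all exponents \<open>1\<close>.
\<close>

definition sums_of :: "('g, 'r) monoid_scheme \<Rightarrow> ('i \<Rightarrow> 'g) \<Rightarrow> 'i set \<Rightarrow> 'g set" where
  "sums_of G a J = finprod G a ` Pow J"

definition zero_sum_free :: "('g, 'r) monoid_scheme \<Rightarrow> ('i \<Rightarrow> 'g) \<Rightarrow> 'i set \<Rightarrow> bool" where
  "zero_sum_free G a J \<longleftrightarrow> (\<forall>I. I \<subseteq> J \<and> I \<noteq> {} \<longrightarrow> finprod G a I \<noteq> \<one>\<^bsub>G\<^esub>)"

lemma zero_sum_free_subset: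
  assumes "zero_sum_free G a J" "K \<subseteq> J"
  shows "zero_sum_free G a K"
  using assms unfolding zero_sum_free_def by blast

lemma finite_sums_of: "finite J \<Longrightarrow> finite (sums_of G a J)"
  by (simp add: sums_of_def)

lemma finprod_in_sums_of: "I \<subseteq> J \<Longrightarrow> finprod G a I \<in> sums_of G a J"
  by (auto simp: sums_of_def)

context comm_group
begin

section \<open>The sums contributed by one term\<close>

lemma sums_of_closed: "a \<in> J \<rightarrow> carrier G \<Longrightarrow> sums_of G a J \<subseteq> carrier G"
  unfolding sums_of_def by (auto intro!: finprod_closed)

lemma inj_on_mult_left:
  assumes "b \<in> carrier G" "P \<subseteq> carrier G"
  shows "inj_on (\<lambda>y. b \<otimes> y) P"
  using assms Units_l_cancel Units_eq by (intro inj_onI) blast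

lemma sums_of_remove:
  assumes fin: "finite J" and a: "a \<in> J \<rightarrow> carrier G" and k: "k \<in> J"
  shows "sums_of G a J = sums_of G a (J - {k}) \<union> (\<lambda>y. a k \<otimes> y) ` sums_of G a (J - {k})"
    (is "?Y = ?X \<union> ?bX")
proof -
  have ins: "finprod G a (insert k I) = a k \<otimes> finprod G a I" if "I \<subseteq> J - {k}" for I
    using that fin a k by (intro finprod_insert) (auto intro: finite_subset)
  have "Pow J = Pow (J - {k}) \<union> insert k ` Pow (J - {k})"
    using k Pow_insert[of k "J - {k}"] by (simp add: insert_absorb)
  then have "?Y = ?X \<union> (\<lambda>I. finprod G a (insert k I)) ` Pow (J - {k})"
    by (simp add: sums_of_def image_Un image_image)
  also have "(\<lambda>I. finprod G a (insert k I)) ` Pow (J - {k}) = ?bX"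
    unfolding sums_of_def image_image by (intro image_cong) (auto simp: ins)
  finally show ?thesis .
qed

lemma one_notin_translate:
  assumes "finite J" "a \<in> J \<rightarrow> carrier G" "zero_sum_free G a J" "k \<in> J"
  shows "\<one> \<notin> (\<lambda>y. a k \<otimes> y) ` sums_of G a (J - {k})"
proof
  assume "\<one> \<in> (\<lambda>y. a k \<otimes> y) ` sums_of G a (J - {k})"
  then obtain I where I: "I \<subseteq> J - {k}" "\<one> = a k \<otimes> finprod G a I"
    by (auto simp: sums_of_def)
  have "finprod G a (insert k I) = a k \<otimes> finprod G a I"
    using I(1) assms by (intro finprod_insert) (auto intro: finite_subset)
  then show False
    using I assms(3,4) unfolding zero_sum_free_def
    by (metis Diff_subset insert_not_empty insert_subset subset_trans)
qed

text \<open>If the full sum were reached without the term \<open>k\<close>, the terms left out would form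
  a nonempty zero-sum subsequence.\<close>

lemma total_notin_sums_of_remove:
  assumes "finite J" "a \<in> J \<rightarrow> carrier G" "zero_sum_free G a J" "k \<in> J"
  shows "finprod G a J \<notin> sums_of G a (J - {k})"
proof
  assume "finprod G a J \<in> sums_of G a (J - {k})"
  then obtain I where I: "I \<subseteq> J - {k}" "finprod G a J = finprod G a I"
    by (auto simp: sums_of_def)
  have cl: "finprod G a I \<in> carrier G" "finprod G a (J - I) \<in> carrier G"
    using I assms(2) by (auto intro!: finprod_closed)
  have "finprod G a (I \<union> (J - I)) = finprod G a I \<otimes> finprod G a (J - I)"
    using I assms(1,2) by (intro finprod_Un_disjoint) (auto intro: finite_subset)
  moreover have "I \<union> (J - I) = J"
    using I by auto
  ultimately have "finprod G a I \<otimes> finprod G a (J - I) = finprod G a I \<otimes> \<one>"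
    using I cl by simp
  then have "finprod G a (J - I) = \<one>"
    using cl by (metis Units_eq Units_l_cancel one_closed)
  moreover have "J - I \<noteq> {}"
    using I assms(4) by auto
  ultimately show False
    using assms(3) unfolding zero_sum_free_def by blast
qed

text \<open>
  The two sets \<open>X\<close> and \<open>b X\<close> have the same size and lie in \<open>Y\<close>; the first misses the full sum and
  the second misses \<open>\<one>\<close>.  If \<open>Y\<close> exceeds them by one element only, nothing else is missed.
\<close>

lemma one_new_sum:
  assumes fin: "finite J" and a: "a \<in> J \<rightarrow> carrier G" and zf: "zero_sum_free G a J"
    and k: "k \<in> J" and card: "card (sums_of G a J) \<le> Suc (card (sums_of G a (J - {k})))"
  shows "sums_of G a J = insert (finprod G a J) (sums_of G a (J - {k}))"
    and "sums_of G a J = insert \<one> ((\<lambda>y. a k \<otimes> y) ` sums_of G a (J - {k}))"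
proof -
  let ?Y = "sums_of G a J" and ?X = "sums_of G a (J - {k})"
  note Y = sums_of_remove[OF fin a k]
  have fX: "finite ?X" and fY: "finite ?Y"
    using fin by (auto intro: finite_sums_of)
  have "finprod G a J \<in> ?Y" "\<one> \<in> ?Y"
    using finprod_in_sums_of[of J J G a] finprod_in_sums_of[of "{}" J G a] by simp_all
  then have sub: "insert (finprod G a J) ?X \<subseteq> ?Y" "insert \<one> ((\<lambda>y. a k \<otimes> y) ` ?X) \<subseteq> ?Y"
    using Y by auto
  have "a k \<in> carrier G" "?X \<subseteq> carrier G"
    using a k sums_of_closed[of a "J - {k}"] by auto
  then have inj: "inj_on (\<lambda>y. a k \<otimes> y) ?X"
    by (rule inj_on_mult_left)
  show "?Y = insert (finprod G a J) ?X"
    using total_notin_sums_of_remove[OF fin a zf k] fX card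
    by (intro card_seteq[OF fY sub(1), symmetric]) simp
  show "?Y = insert \<one> ((\<lambda>y. a k \<otimes> y) ` ?X)"
    using one_notin_translate[OF fin a zf k] fX card
    by (intro card_seteq[OF fY sub(2), symmetric]) (simp add: card_image[OF inj])
qed

section \<open>Sequences in which every term contributes one sum\<close>

text \<open>
  Remove the term \<open>j\<close> from the full sum \<open>s\<close>, then multiply by the term \<open>i\<close> and by the term \<open>j\<close>.
  As the two terms differ, neither multiplication is applied to \<open>s\<close> itself, so the result,
  \<open>s\<close> times the term \<open>i\<close>, is again a sum.  If it were different from \<open>\<one>\<close>, it would be the
  term \<open>i\<close> times a sum that avoids \<open>i\<close>, which makes \<open>s\<close> such a sum, against zero-sum freeness.
\<close>

lemma total_times_term_eq_one:
  assumes fin: "finite J" and a: "a \<in> J \<rightarrow> carrier G" and zf: "zero_sum_free G a J"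
    and card: "\<And>k. k \<in> J \<Longrightarrow> card (sums_of G a J) \<le> Suc (card (sums_of G a (J - {k})))"
    and ij: "i \<in> J" "j \<in> J" "a i \<noteq> a j"
  shows "a i \<otimes> finprod G a J = \<one>"
proof (rule ccontr)
  assume ne: "a i \<otimes> finprod G a J \<noteq> \<one>"
  let ?Y = "sums_of G a J" and ?s = "finprod G a J" and ?z = "finprod G a (J - {j})"
  \<comment> \<open>Every sum other than \<open>s\<close> can be formed without the term \<open>k\<close>, which is thus free to be added.\<close>
  have closure: "a k \<otimes> y \<in> ?Y" if "k \<in> J" "y \<in> ?Y" "y \<noteq> ?s" for k y
    using one_new_sum(1)[OF fin a zf that(1) card[OF that(1)]] that sums_of_remove[OF fin a that(1)]
    by auto
  have ai: "a i \<in> carrier G" and aj: "a j \<in> carrier G"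
    using a ij by auto
  have z: "?z \<in> carrier G" and s: "?s \<in> carrier G"
    using a by (auto intro!: finprod_closed)
  have "finprod G a (insert j (J - {j})) = a j \<otimes> ?z"
    using fin a ij by (intro finprod_insert) auto
  then have sz: "?s = a j \<otimes> ?z"
    using ij by (simp add: insert_absorb)
  have zX: "?z \<in> sums_of G a (J - {j})" and zY: "?z \<in> ?Y"
    by (auto intro: finprod_in_sums_of)
  have "?z \<noteq> ?s"
    using zX total_notin_sums_of_remove[OF fin a zf ij(2)] by auto
  then have "a i \<otimes> ?z \<in> ?Y"
    using closure ij zY by blast
  moreover have "a i \<otimes> ?z \<noteq> ?s"
    using sz ai aj z ij(3) by (metis right_cancel)
  ultimately have "a j \<otimes> (a i \<otimes> ?z) \<in> ?Y"
    using closure ij by blast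
  then have "a i \<otimes> ?s \<in> ?Y"
    using sz ai aj z by (metis m_lcomm)
  then have "a i \<otimes> ?s \<in> (\<lambda>y. a i \<otimes> y) ` sums_of G a (J - {i})"
    using one_new_sum(2)[OF fin a zf ij(1) card[OF ij(1)]] ne by auto
  then obtain y where y: "y \<in> sums_of G a (J - {i})" "a i \<otimes> ?s = a i \<otimes> y"
    by blast
  moreover have "y \<in> carrier G"
    using y(1) sums_of_closed[of a "J - {i}"] a by auto
  ultimately have "?s \<in> sums_of G a (J - {i})"
    using ai s by (metis Units_eq Units_l_cancel)
  then show False
    using total_notin_sums_of_remove[OF fin a zf ij(1)] by blast
qed

text \<open>Two distinct terms would both be the inverse of the full sum.\<close>

lemma one_new_sum_imp_all_equal:
  assumes fin: "finite J" and a: "a \<in> J \<rightarrow> carrier G" and zf: "zero_sum_free G a J"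
    and card: "\<And>k. k \<in> J \<Longrightarrow> card (sums_of G a J) \<le> Suc (card (sums_of G a (J - {k})))"
    and ij: "i \<in> J" "j \<in> J"
  shows "a i = a j"
proof (rule ccontr)
  assume ne: "a i \<noteq> a j"
  have "a i \<otimes> finprod G a J = \<one>" "a j \<otimes> finprod G a J = \<one>"
    using total_times_term_eq_one[OF fin a zf card] ij ne by metis+
  moreover have "finprod G a J \<in> carrier G" "a i \<in> carrier G" "a j \<in> carrier G"
    using a ij by (auto intro!: finprod_closed)
  ultimately show False
    using ne by (metis right_cancel)
qed

lemma finprod_powers:
  fixes x :: "'i \<Rightarrow> nat"
  assumes "finite J" "g \<in> carrier G" "\<And>k. k \<in> J \<Longrightarrow> a k = g [^] x k"
  shows "finprod G a J = g [^] sum x J"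
  using assms
proof (induction J rule: finite_induct)
  case (insert k J)
  have "finprod G a (insert k J) = a k \<otimes> finprod G a J"
    using insert by (intro finprod_insert) auto
  then show ?case
    using insert by (simp add: nat_pow_mult)
qed simp

lemma constant_zero_sum_free:
  assumes fin: "finite J" and g: "g \<in> carrier G" and const: "\<And>k. k \<in> J \<Longrightarrow> a k = g"
    and ordpos: "0 < ord g" and zf: "zero_sum_free G a J"
  shows "card J < ord g" and "sums_of G a J = (\<lambda>i. g [^] i) ` {0..card J}"
proof -
  have pow: "finprod G a I = g [^] card I" if "I \<subseteq> J" for I
    using finprod_powers[of I g a "\<lambda>_. 1"] that fin const g by (auto intro: finite_subset)
  show "card J < ord g"
  proof (rule ccontr)
    assume "\<not> card J < ord g"
    then obtain I where I: "I \<subseteq> J" "card I = ord g"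
      using obtain_subset_with_card_n[of "ord g" J] by (metis not_less)
    then have "finprod G a I = \<one>"
      using pow pow_ord_eq_1[OF g] by simp
    moreover have "I \<noteq> {}"
      using I ordpos by auto
    ultimately show False
      using I zf unfolding zero_sum_free_def by blast
  qed
  have "card ` Pow J = {0..card J}"
  proof
    show "card ` Pow J \<subseteq> {0..card J}"
      using fin by (auto intro: card_mono)
    show "{0..card J} \<subseteq> card ` Pow J"
    proof
      fix i assume "i \<in> {0..card J}"
      then have "i \<le> card J"
        by simp
      then obtain I where "I \<subseteq> J" "card I = i"
        by (rule obtain_subset_with_card_n)
      then show "i \<in> card ` Pow J"
        by (intro image_eqI[of _ _ I]) auto
    qed
  qed
  moreover have "sums_of G a J = (\<lambda>i. g [^] i) ` card ` Pow J"
    unfolding sums_of_def image_image by (intro image_cong) (auto simp: pow)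
  ultimately show "sums_of G a J = (\<lambda>i. g [^] i) ` {0..card J}"
    by (simp only:)
qed

section \<open>Prolonging a progression\<close>

text \<open>
  The size bound makes the progression meet its translate, so \<open>b = g [^] (p - q)\<close> for some
  \<open>p, q \<le> m\<close>.  That \<open>\<one>\<close> is not in the translate excludes \<open>p \<le> q\<close>, and also excludes
  that the translate wraps around past \<open>g [^] ord g\<close>.
\<close>

lemma progression_overlapping_translate:
  fixes m :: nat
  assumes g: "g \<in> carrier G" and b: "b \<in> carrier G" and m: "m < ord g"
    and P: "P = (\<lambda>i. g [^] i) ` {0..m}"
    and one: "\<one> \<notin> (\<lambda>y. b \<otimes> y) ` P"
    and card: "card (P \<union> (\<lambda>y. b \<otimes> y) ` P) < 2 * (m + 1)"
  obtains j :: nat where "0 < j" "b = g [^] j" "m + j < ord g"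
    "P \<union> (\<lambda>y. b \<otimes> y) ` P = (\<lambda>i. g [^] i) ` {0..m + j}"
proof -
  have not1: "b \<otimes> g [^] i \<noteq> \<one>" if "i \<le> m" for i
    using one that unfolding P by force
  have "P \<inter> (\<lambda>y. b \<otimes> y) ` P \<noteq> {}"
  proof
    assume "P \<inter> (\<lambda>y. b \<otimes> y) ` P = {}"
    then have "card (P \<union> (\<lambda>y. b \<otimes> y) ` P) = card P + card ((\<lambda>y. b \<otimes> y) ` P)"
      by (intro card_Un_disjoint) (auto simp: P)
    moreover have "card P = m + 1"
      using inj_on_subset[OF ord_inj[OF g], of "{0..m}"] m by (simp add: P card_image)
    moreover have "P \<subseteq> carrier G"
      using g by (auto simp: P)
    then have "inj_on (\<lambda>y. b \<otimes> y) P"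
      by (rule inj_on_mult_left[OF b])
    then have "card ((\<lambda>y. b \<otimes> y) ` P) = card P"
      by (rule card_image)
    ultimately show False
      using card by simp
  qed
  then obtain p q where pq: "p \<le> m" "q \<le> m" "g [^] p = b \<otimes> g [^] q"
    unfolding P by auto
  have qp: "q < p"
  proof (rule ccontr)
    assume "\<not> q < p"
    then have "g [^] q = g [^] (q - p) \<otimes> g [^] p"
      using g by (simp add: nat_pow_mult)
    then have "\<one> \<otimes> g [^] p = (b \<otimes> g [^] (q - p)) \<otimes> g [^] p"
      using pq(3) g b by (simp add: m_assoc)
    then have "b \<otimes> g [^] (q - p) = \<one>"
      using g b by (metis m_closed nat_pow_closed one_closed right_cancel)
    then show False
      using not1[of "q - p"] pq by simp
  qed
  define j where "j = p - q"
  have j: "0 < j" "j \<le> m"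
    using qp pq by (auto simp: j_def)
  have "g [^] j \<otimes> g [^] q = b \<otimes> g [^] q"
    using g qp pq(3) by (simp add: j_def nat_pow_mult)
  then have bj: "b = g [^] j"
    using g b by (metis nat_pow_closed right_cancel)
  have mj: "m + j < ord g"
  proof (rule ccontr)
    assume "\<not> m + j < ord g"
    then have "b \<otimes> g [^] (ord g - j) = \<one>" "ord g - j \<le> m"
      using g j m by (auto simp: bj nat_pow_mult pow_ord_eq_1)
    then show False
      using not1 by blast
  qed
  have "(\<lambda>y. b \<otimes> y) ` P = (\<lambda>i. g [^] i) ` ((+) j ` {0..m})"
    unfolding P image_image by (intro image_cong) (auto simp: bj nat_pow_mult g)
  then have "P \<union> (\<lambda>y. b \<otimes> y) ` P = (\<lambda>i. g [^] i) ` ({0..m} \<union> {j..m + j})"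
    by (simp add: P image_Un add.commute)
  moreover have "{0..m} \<union> {j..m + j} = {0..m + j}"
    using j by auto
  ultimately show ?thesis
    using that j bj mj by simp
qed

section \<open>Zero-sum free sequences with few sums\<close>

text \<open>
  The induction carries along that the sums fill the whole progression, since the next term is
  recognised as a power of \<open>g\<close> by the overlap of this progression with its translate.
\<close>

lemma zero_sum_free_few_sums:
  assumes fin: "finite J" and finG: "finite (carrier G)" and a: "a \<in> J \<rightarrow> carrier G"
    and zf: "zero_sum_free G a J" and few: "card (sums_of G a J) < 2 * card J"
  shows "\<exists>g \<in> carrier G. \<exists>x :: 'i \<Rightarrow> nat. (\<forall>k \<in> J. 0 < x k \<and> a k = g [^] x k) \<and>
           sum x J < ord g \<and> sums_of G a J = (\<lambda>i. g [^] i) ` {0..sum x J}"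
  using fin a zf few
proof (induction J rule: finite_psubset_induct)
  case (psubset J)
  note fin = psubset.hyps(1) and a = psubset.prems(1) and zf = psubset.prems(2)
  note few = psubset.prems(3)
  show ?case
  proof (cases "\<forall>k\<in>J. card (sums_of G a J) \<le> Suc (card (sums_of G a (J - {k})))")
    case True
    obtain k where k: "k \<in> J"
      using few by fastforce
    have g: "a k \<in> carrier G"
      using a k by auto
    have const: "a i = a k" if "i \<in> J" for i
      using one_new_sum_imp_all_equal[OF fin a zf _ that k] True by blast
    have "0 < ord (a k)"
      using ord_ge_1[OF finG g] by simp
    note prog = constant_zero_sum_free[OF fin g const this zf]
    show ?thesis
      using g const prog by (intro bexI[of _ "a k"] exI[of _ "\<lambda>_. 1"]) auto
  next
    case False
    then obtain k where k: "k \<in> J"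
      and two: "Suc (card (sums_of G a (J - {k}))) < card (sums_of G a J)"
      by (auto simp: not_le)
    let ?K = "J - {k}"
    have cJ: "card ?K = card J - 1" "0 < card J"
      using fin k by (auto simp: card_gt_0_iff)
    \<comment> \<open>Deleting \<open>k\<close> lowers the bound \<open>2 * card J\<close> by two and the number of sums by at least two.\<close>
    have "?K \<subset> J" "a \<in> ?K \<rightarrow> carrier G" "card (sums_of G a ?K) < 2 * card ?K"
      using k a two few cJ by auto
    then obtain g x where g: "g \<in> carrier G" and x: "\<forall>i\<in>?K. 0 < x i \<and> a i = g [^] x i"
      and ordg: "sum x ?K < ord g" and prog: "sums_of G a ?K = (\<lambda>i. g [^] i) ` {0..sum x ?K}"
      using psubset.IH[of ?K] zero_sum_free_subset[OF zf, of ?K] by blast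
    note Y = sums_of_remove[OF fin a k]
    \<comment> \<open>Positive exponents make the progression so long that there is no room for a disjoint translate.\<close>
    have "card ?K \<le> sum x ?K"
      using x sum_mono[of ?K "\<lambda>_. 1" x] by (simp add: Suc_le_eq)
    then have small: "card (sums_of G a ?K \<union> (\<lambda>y. a k \<otimes> y) ` sums_of G a ?K) < 2 * (sum x ?K + 1)"
      using few cJ unfolding Y by arith
    have ak: "a k \<in> carrier G"
      using a k by auto
    obtain j where j: "0 < j" "a k = g [^] j" "sum x ?K + j < ord g"
      "sums_of G a J = (\<lambda>i. g [^] i) ` {0..sum x ?K + j}"
      using progression_overlapping_translate
        [OF g ak ordg prog one_notin_translate[OF fin a zf k] small, folded Y]
      by blast
    let ?x = "x(k := j)"
    have "sum ?x ?K = sum x ?K"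
      by (intro sum.cong) auto
    then have "sum ?x J = sum x ?K + j"
      using sum.remove[OF fin k, of ?x] by simp
    moreover have "\<forall>i\<in>J. 0 < ?x i \<and> a i = g [^] ?x i"
      using x j by auto
    ultimately show ?thesis
      using g j by (intro bexI[of _ g] exI[of _ ?x]) auto
  qed
qed

end

theorem corollary1:
  fixes G :: "('g, 'r) monoid_scheme" and n :: nat and a :: "nat \<Rightarrow> 'g"
  assumes "comm_group G"
    and "finite (carrier G)"
    and "a \<in> {1..n} \<rightarrow> carrier G"
    and "minimal_zero_sum G n a"
    and "int (card (subsequence_sums G n a)) < 2 * (int n - 1)"
  shows "\<exists>g \<in> carrier G. \<exists>x :: nat \<Rightarrow> nat.
           (\<forall>k \<in> {1..n}. x k > 0) \<and>
           (\<Sum>k = 1..n. x k) = group.ord G g \<and>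
           (\<forall>k \<in> {1..n}. a k = g [^]\<^bsub>G\<^esub> x k)"
proof -
  interpret comm_group G by fact
  let ?J = "{1..n} - {n}"
  have n: "n \<in> {1..n}"
    using assms(5) by (cases n) auto
  have a: "a \<in> ?J \<rightarrow> carrier G" and an: "a n \<in> carrier G"
    using assms(3) n by auto
  have zf: "zero_sum_free G a ?J"
    unfolding zero_sum_free_def
  proof (intro allI impI)
    fix I assume I: "I \<subseteq> ?J \<and> I \<noteq> {}"
    then have "I \<subset> {1..n}"
      using n by blast
    then show "finprod G a I \<noteq> \<one>\<^bsub>G\<^esub>"
      using I assms(4) unfolding minimal_zero_sum_def zero_sum_def by blast
  qed
  have "subsequence_sums G n a = sums_of G a {1..n}"
    by (auto simp: subsequence_sums_def sums_of_def)
  moreover have "sums_of G a ?J \<subseteq> sums_of G a {1..n}"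
    unfolding sums_of_def by (intro image_mono) auto
  ultimately have "card (sums_of G a ?J) \<le> card (subsequence_sums G n a)"
    by (simp add: card_mono finite_sums_of)
  then have few: "card (sums_of G a ?J) < 2 * card ?J"
    using assms(5) n by auto
  obtain g x where g: "g \<in> carrier G" and x: "\<forall>k\<in>?J. 0 < x k \<and> a k = g [^]\<^bsub>G\<^esub> x k"
    and ordg: "sum x ?J < ord g"
    using zero_sum_free_few_sums[OF _ assms(2) a zf few] by auto
  have prodJ: "finprod G a ?J = g [^]\<^bsub>G\<^esub> sum x ?J"
    using x g by (intro finprod_powers) auto
  have "finprod G a (insert n ?J) = a n \<otimes>\<^bsub>G\<^esub> finprod G a ?J"
    using a an by (intro finprod_insert) auto
  then have "a n \<otimes>\<^bsub>G\<^esub> g [^]\<^bsub>G\<^esub> sum x ?J = \<one>\<^bsub>G\<^esub>"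
    using n assms(4) prodJ by (simp add: insert_absorb minimal_zero_sum_def zero_sum_def)
  moreover have "g [^]\<^bsub>G\<^esub> (ord g - sum x ?J) \<otimes>\<^bsub>G\<^esub> g [^]\<^bsub>G\<^esub> sum x ?J = \<one>\<^bsub>G\<^esub>"
    using g ordg by (simp add: nat_pow_mult pow_ord_eq_1)
  ultimately have an_pow: "a n = g [^]\<^bsub>G\<^esub> (ord g - sum x ?J)"
    using g an by (metis nat_pow_closed right_cancel)
  let ?x = "x(n := ord g - sum x ?J)"
  have "sum ?x ?J = sum x ?J"
    by (intro sum.cong) auto
  then have "sum ?x {1..n} = ord g"
    using sum.remove[OF _ n, of ?x] ordg by simp
  moreover have "\<forall>k\<in>{1..n}. ?x k > 0 \<and> a k = g [^]\<^bsub>G\<^esub> ?x k"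
    using x an_pow ordg by auto
  ultimately show ?thesis
    using g by (intro bexI[of _ g] exI[of _ ?x]) auto
qed

end
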